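(* Let $q > 3$ be an odd prime power. Let $C_0 = \{e^2 : e \in \mathbb{F}_q^*\}$ and $C_1 = \mathbb{F}_q^* \setminus C_0$. Fix $s, t \in \{0,1\}$ and let $f_s(x) \in \mathbb{F}_q[x]$ induce a bijection from $C_s$ to $C_t$. For each integer $i$ with $(q+1)/2 \le i \le q-2$, define coefficients $b_{ik} \in \mathbb{F}_q$ by $$f_s(x)^{q-1-i} \equiv \sum_{0 \le k \le q-1} b_{ik} x^k \pmod{x^q - x}.$$ Then the inverse of $f_s(x)$ restricted to $C_s$ is $$f_s^{-1}(x) = \sum_{(q+1)/2 \le i \le q-2} (-1)^{s+t}\left(b_{i,(q-3)/2} + (-1)^s b_{i,q-2}\right) x^{\,i - \frac{q-1}{2}},$$ in the sense of reduction modulo $x^{\frac{q-1}{2}} + (-1)^{t+1}$. That is, this polynomial is congruent modulo $x^{\frac{q-1}{2}} + (-1)^{t+1}$ to the polynomial $h(x) \in \mathbb{F}_q[x]$ of degree at most $q-1$ with $h(0) = 0$ and $h(f_s(c)) = c$ for all $c \in C_s$. In particular, it satisfies $f_s^{-1}(f_s(c)) = c$ for every $c \in C_s$. *)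

theory Defs
  imports "HOL-Number_Theory.Number_Theory" "HOL-Computational_Algebra.Computational_Algebra" "HOL-Library.Cardinality"
begin

definition quad_class :: "nat \<Rightarrow> 'a::field set" where
  "quad_class j = (if j = 0 then {e\<^sup>2 | e. e \<noteq> 0} else {x. x \<noteq> 0} - {e\<^sup>2 | e. e \<noteq> 0})"

text \<open>
  In \<open>inverse_poly\<close>, \<open>b i k\<close> is the coefficient of \<open>x\<^sup>k\<close> in the reduction of the
  \<open>(q - 1 - i)\<close>-th power of the given polynomial modulo \<open>x\<^sup>q - x\<close>. For odd \<open>q > 3\<close>, all natural
  number divisions below are exact and no subtraction truncates.
\<close>

definition inverse_poly ::
    "nat \<Rightarrow> nat \<Rightarrow> nat \<Rightarrow> (nat \<Rightarrow> nat \<Rightarrow> 'a) \<Rightarrow> 'a::field poly" where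
  "inverse_poly q s t b =
     (\<Sum>i = (q + 1) div 2..q - 2.
        monom ((-1) ^ (s + t) * (b i ((q - 3) div 2) + (-1) ^ s * b i (q - 2)))
              (i - (q - 1) div 2))"

text \<open>
  The conditions on \<open>h\<close> do not prescribe its values outside \<open>poly f ` A\<close> and \<open>0\<close>, so in
  general they are satisfied by several polynomials.
\<close>

definition is_inverse_on :: "nat \<Rightarrow> 'a::field set \<Rightarrow> 'a poly \<Rightarrow> 'a poly \<Rightarrow> bool" where
  "is_inverse_on q A f h \<longleftrightarrow>
     degree h \<le> q - 1 \<and> poly h 0 = 0 \<and> (\<forall>c\<in>A. poly h (poly f c) = c)"

end

theory Submission
  imports Defs
begin

text \<open>
  Put \<open>m = (q - 1) / 2\<close>. By Euler's criterion \<open>C\<^sub>t\<close> is the set of roots of \<open>x\<^sup>m - (-1)\<^sup>t\<close>, so a polynomial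
  is determined on \<open>C\<^sub>t\<close> exactly up to multiples of this modulus. For \<open>c \<in> C\<^sub>s\<close>, orthogonality gives
  \<open>m c = (\<Sum>j<m. (\<Sum>d\<in>C\<^sub>s. d f(d)\<^sup>-\<^sup>j) f(c)\<^sup>j)\<close>. As \<open>f(d)\<^sup>-\<^sup>j = (-1)\<^sup>t f(d)\<^sup>m\<^sup>-\<^sup>j\<close>, the inner sum
  is a combination of the power sums \<open>\<Sum>d\<in>C\<^sub>s. d\<^sup>k\<^sup>+\<^sup>1\<close> with coefficients \<open>b\<close>, and such a power sum vanishes
  unless \<open>m\<close> divides \<open>k + 1\<close>, that is, unless \<open>k = m - 1\<close> or \<open>k = q - 2\<close>.
\<close>

section \<open>Powers and characteristic in a finite field of odd order\<close>

text \<open>Multiplication by \<open>x\<close> permutes the nonzero elements, so their nonzero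
  product is unchanged when scaled by \<open>x ^ (CARD('a) - 1)\<close>.\<close>

lemma power_card_minus_one_eq_one:
  fixes x :: "'a::{field,finite}"
  assumes "x \<noteq> 0"
  shows "x ^ (CARD('a) - 1) = 1"
proof -
  let ?U = "UNIV - {0::'a}"
  have "(\<Prod>y\<in>?U. y) = (\<Prod>y\<in>?U. x * y)"
    by (rule prod.reindex_bij_witness[of _ "\<lambda>y. x * y" "\<lambda>y. y / x"]) (use assms in auto)
  also have "\<dots> = x ^ (CARD('a) - 1) * (\<Prod>y\<in>?U. y)"
    by (simp add: prod.distrib)
  finally show ?thesis
    by simp
qed

lemma card_power_eq_le:
  fixes a :: "'a::idom"
  assumes "n > 0"
  shows "card {x. x ^ n = a} \<le> n"
proof -
  let ?p = "monom 1 n - [:a:]"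
  have "coeff ?p n = 1"
    using assms by (simp add: coeff_pCons split: nat.splits)
  hence "?p \<noteq> 0"
    by (metis coeff_0 zero_neq_one)
  hence "card {x. poly ?p x = 0} \<le> degree ?p"
    by (rule card_poly_roots_bound)
  also have "degree ?p \<le> n"
    by (intro degree_diff_le) (auto simp: degree_monom_eq)
  finally show ?thesis
    by (simp add: poly_monom)
qed

text \<open>The order of the field vanishes in it, so \<open>2 * of_nat m + 1 = 0\<close>; if
  \<open>of_nat m\<close> or \<open>2\<close> were zero, this would read
  \<open>1 = 0\<close>.\<close>

lemma
  assumes "CARD('a::{field,finite}) = 2 * m + 1"
  shows of_nat_half_card_neq_zero: "of_nat m \<noteq> (0::'a)"
    and one_neq_minus_one_of_odd_card: "(1::'a) \<noteq> -1"
proof -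
  have "of_nat CARD('a) = (0::'a)"
    using CHAR_dvd_CARD[where 'a = 'a] by (simp only: of_nat_eq_0_iff_char_dvd)
  hence eq: "2 * of_nat m + 1 = (0::'a)"
    unfolding assms by (simp add: add.commute)
  thus "of_nat m \<noteq> (0::'a)"
    by auto
  show "(1::'a) \<noteq> -1"
  proof
    assume "(1::'a) = -1"
    hence "(2::'a) = 0"
      by (metis add.right_inverse one_add_one)
    with eq show False
      by simp
  qed
qed

section \<open>Squares and nonsquares as solutions of \<open>x ^ m = 1\<close> and
  \<open>x ^ m = -1\<close>\<close>

text \<open>Squaring is at most two-to-one on the \<open>2 * m\<close> nonzero elements, so there
  are at least \<open>m\<close> squares. All of them solve \<open>x ^ m = 1\<close>, which has at
  most \<open>m\<close> solutions, so both bounds are attained.\<close>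

lemma
  assumes "CARD('a::{field,finite}) = 2 * m + 1" and "m > 0"
  shows squares_eq_roots_of_unity: "{e\<^sup>2 | e::'a. e \<noteq> 0} = {x. x ^ m = 1}"
    and card_roots_of_unity: "card {x::'a. x ^ m = 1} = m"
proof -
  let ?S = "{e\<^sup>2 | e::'a. e \<noteq> 0}"
  have sub: "?S \<subseteq> {x. x ^ m = 1}"
    using power_card_minus_one_eq_one[where 'a = 'a] assms(1)
    by (auto simp: power_mult[symmetric])
  have "2 * m = card (UNIV - {0::'a})"
    using assms(1) by simp
  also have "\<dots> \<le> card (\<Union>y\<in>?S. {e. e\<^sup>2 = y})"
    by (intro card_mono) auto
  also have "\<dots> \<le> (\<Sum>y\<in>?S. card {e. e\<^sup>2 = y})"
    by (rule card_UN_le) simp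
  also have "\<dots> \<le> (\<Sum>y\<in>?S. 2)"
    by (intro sum_mono card_power_eq_le) simp
  finally have ge: "m \<le> card ?S"
    by simp
  have le: "card {x::'a. x ^ m = 1} \<le> m"
    using assms(2) by (rule card_power_eq_le)
  have "card ?S \<le> card {x::'a. x ^ m = 1}"
    using sub by (intro card_mono) auto
  with ge le show "card {x::'a. x ^ m = 1} = m"
    by linarith
  with ge sub show "?S = {x. x ^ m = 1}"
    by (intro card_seteq) auto
qed

lemma quad_class_eq:
  assumes "CARD('a::{field,finite}) = 2 * m + 1" and "m > 0" and "t \<in> {0, 1}"
  shows "quad_class t = {x::'a. x ^ m = (-1) ^ t}"
proof -
  have pm1: "x ^ m = 1 \<or> x ^ m = -1" if "x \<noteq> 0" for x :: 'a
  proof -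
    have "(x ^ m)\<^sup>2 = 1"
      using power_card_minus_one_eq_one[OF that] assms(1)
      by (simp add: power_mult[symmetric] mult.commute)
    thus ?thesis
      by (simp add: power2_eq_1_iff)
  qed
  \<comment> \<open>Zero satisfies neither side, because \<open>0 ^ m = 0\<close> for
    \<open>m > 0\<close>.\<close>
  have nonsquare: "x \<noteq> 0 \<and> x ^ m \<noteq> 1 \<longleftrightarrow> x ^ m = -1" for x :: 'a
    using pm1[of x] assms(2) one_neq_minus_one_of_odd_card[OF assms(1)]
    by (cases "x = 0") (auto simp: zero_power)
  show ?thesis
  proof (cases "t = 0")
    case False
    have "{x. x \<noteq> 0} - {x. x ^ m = 1} = {x::'a. x ^ m = -1}"
      using nonsquare by blast
    thus ?thesis
      using False assms(3) by (simp add: quad_class_def squares_eq_roots_of_unity[OF assms(1,2)])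
  qed (simp add: quad_class_def squares_eq_roots_of_unity[OF assms(1,2)])
qed

lemma card_quad_class:
  assumes "CARD('a::{field,finite}) = 2 * m + 1" and "m > 0" and "t \<in> {0, 1}"
  shows "card (quad_class t :: 'a set) = m"
proof (cases "t = 0")
  case True
  thus ?thesis
    using card_roots_of_unity[OF assms(1,2)]
    by (simp add: quad_class_def squares_eq_roots_of_unity[OF assms(1,2)])
next
  case False
  have "{x::'a. x \<noteq> 0} = UNIV - {0}"
    by auto
  hence "card {x::'a. x \<noteq> 0} = 2 * m"
    using assms(1) by simp
  moreover have "card ({x. x \<noteq> 0} - {x::'a. x ^ m = 1}) = card {x::'a. x \<noteq> 0} - card {x::'a. x ^ m = 1}"
    using assms(2) by (intro card_Diff_subset) (auto simp: zero_power)
  ultimately show ?thesis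
    using False
    by (simp add: quad_class_def squares_eq_roots_of_unity[OF assms(1,2)]
        card_roots_of_unity[OF assms(1,2)])
qed

section \<open>Power sums over a quadratic class\<close>

text \<open>If \<open>m\<close> divides \<open>n\<close>, all summands are equal. Otherwise some
  \<open>g\<close> with \<open>g ^ m = 1\<close> has \<open>g ^ n \<noteq> 1\<close>; multiplication
  by \<open>g\<close> permutes the class, so the sum equals \<open>g ^ n\<close> times
  itself.\<close>

lemma sum_power_quad_class:
  assumes card: "CARD('a::{field,finite}) = 2 * m + 1" and m: "m > 0" and s: "s \<in> {0, 1}"
  shows "(\<Sum>c\<in>quad_class s. c ^ n) =
    (if m dvd n then of_nat m * (-1) ^ (s * (n div m)) else (0::'a))"
proof (cases "m dvd n")
  case True
  have "c ^ n = (-1) ^ (s * (n div m))" if "c \<in> quad_class s" for c :: 'a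
  proof -
    have "c ^ n = (c ^ m) ^ (n div m)"
      using True by (simp flip: power_mult)
    thus ?thesis
      using that by (simp add: quad_class_eq[OF assms] power_mult)
  qed
  thus ?thesis
    using True by (simp add: card_quad_class[OF assms])
next
  case False
  define r where "r = n mod m"
  have r: "0 < r" "r < m"
    using False m by (auto simp: r_def dvd_eq_mod_eq_0)
  \<comment> \<open>There are \<open>m\<close> solutions of \<open>g ^ m = 1\<close>, but at most
    \<open>r < m\<close> of \<open>g ^ r = 1\<close>.\<close>
  have "\<not> {g::'a. g ^ m = 1} \<subseteq> {g. g ^ r = 1}"
    using card_mono[of "{g::'a. g ^ r = 1}" "{g. g ^ m = 1}"] r
      card_power_eq_le[of r "1::'a"] card_roots_of_unity[OF card m] by auto
  then obtain g :: 'a where g: "g ^ m = 1" "g ^ r \<noteq> 1"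
    by auto
  have "n = m * (n div m) + r"
    by (simp add: r_def)
  hence "g ^ n = (g ^ m) ^ (n div m) * g ^ r"
    by (metis power_add power_mult)
  hence gn: "g ^ n \<noteq> 1"
    using g by simp
  have g0: "g \<noteq> 0"
    using g(1) m by (auto simp: zero_power)
  have "(\<Sum>c\<in>quad_class s. c ^ n) = (\<Sum>c\<in>quad_class s. (g * c) ^ n)"
    by (rule sum.reindex_bij_witness[of _ "\<lambda>c. g * c" "\<lambda>c. c / g"])
      (use g0 g(1) in \<open>auto simp: quad_class_eq[OF assms] power_mult_distrib power_divide\<close>)
  also have "\<dots> = g ^ n * (\<Sum>c\<in>quad_class s. c ^ n)"
    by (simp add: power_mult_distrib sum_distrib_left)
  finally show ?thesis
    using gn False by simp
qed

section \<open>Congruences of polynomials and their values\<close>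

lemma poly_eq_if_cong_field_poly:
  fixes p r :: "'a::{field,finite} poly"
  assumes "[p = r] (mod (monom 1 CARD('a) - monom 1 1))"
  shows "poly p x = poly r x"
proof -
  obtain k where k: "p - r = (monom 1 CARD('a) - monom 1 1) * k"
    using assms by (auto simp: cong_iff_dvd_diff)
  have "x ^ CARD('a) = x"
  proof (cases "x = 0")
    case False
    have "x ^ CARD('a) = x ^ (CARD('a) - 1) * x"
      by (simp flip: power_Suc2)
    thus ?thesis
      using power_card_minus_one_eq_one[OF False] by simp
  qed (simp add: zero_power)
  hence "poly (p - r) x = 0"
    unfolding k by (simp add: poly_monom)
  thus ?thesis
    by simp
qed

text \<open>The remainder of \<open>p - r\<close> modulo \<open>M\<close> vanishes on
  \<open>A\<close> and has degree below \<open>card A\<close>, so it is zero.\<close>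

lemma cong_if_eq_on_roots:
  fixes p r M :: "'a::field poly"
  assumes "0 < degree M" and "degree M \<le> card A"
    and "\<And>x. x \<in> A \<Longrightarrow> poly M x = 0" and "\<And>x. x \<in> A \<Longrightarrow> poly p x = poly r x"
  shows "[p = r] (mod M)"
proof -
  let ?D = "(p - r) mod M"
  have "?D = 0"
  proof (rule poly_eqI_degree[where A = A])
    fix x assume x: "x \<in> A"
    have "poly (p - r) x = poly ((p - r) div M) x * poly M x + poly ?D x"
      by (simp flip: poly_mult poly_add)
    thus "poly ?D x = poly 0 x"
      using assms(3,4)[OF x] by simp
  next
    have "degree ?D < degree M"
      using assms(1) degree_mod_less[of M "p - r"] by (cases "M = 0") auto
    thus "degree ?D < card A"
      using assms(2) by simp
  qed (use assms(1,2) in simp)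
  thus ?thesis
    by (simp add: cong_iff_dvd_diff dvd_eq_mod_eq_0)
qed

section \<open>Interpolation and evaluation of its coefficients\<close>

text \<open>After swapping the sums, the inner one is geometric with ratio \<open>g c / g d\<close>.
  This ratio is an \<open>m\<close>-th root of unity, equal to 1 only for \<open>d = c\<close> by
  injectivity, so only the term \<open>d = c\<close> survives.\<close>

lemma sum_interpolation_quad_class:
  fixes g :: "'a::{field,finite} \<Rightarrow> 'a"
  assumes card: "CARD('a) = 2 * m + 1" and m: "m > 0" and t: "t \<in> {0, 1}"
    and inj: "inj_on g A" and img: "g ` A \<subseteq> quad_class t" and c: "c \<in> A"
  shows "(\<Sum>j<m. (\<Sum>d\<in>A. d / g d ^ j) * g c ^ j) = of_nat m * c"
proof -
  have gm: "g d ^ m = (-1) ^ t" if "d \<in> A" for d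
    using that img by (auto simp: quad_class_eq[OF card m t])
  have g0: "g d \<noteq> 0" if "d \<in> A" for d
    using gm[OF that] m by (auto simp: zero_power)
  have geometric: "(\<Sum>j<m. (g c / g d) ^ j) = (if d = c then of_nat m else 0)" if "d \<in> A" for d
  proof (cases "d = c")
    case True
    thus ?thesis
      using g0[OF that] by simp
  next
    case False
    hence "g c / g d \<noteq> 1"
      using inj c that g0[OF that] by (auto simp: inj_on_def)
    thus ?thesis
      using False gm[OF that] gm[OF c]
      by (subst geometric_sum) (simp_all add: power_divide)
  qed
  have "(\<Sum>j<m. (\<Sum>d\<in>A. d / g d ^ j) * g c ^ j) = (\<Sum>j<m. \<Sum>d\<in>A. d * (g c / g d) ^ j)"
    by (simp add: sum_distrib_right power_divide)
  also have "\<dots> = (\<Sum>d\<in>A. d * (\<Sum>j<m. (g c / g d) ^ j))"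
    by (subst sum.swap) (simp add: sum_distrib_left)
  also have "\<dots> = (\<Sum>d\<in>A. if d = c then d * of_nat m else 0)"
    by (intro sum.cong) (simp_all add: geometric)
  also have "\<dots> = of_nat m * c"
    using c by (simp add: mult.commute)
  finally show ?thesis .
qed

lemma sum_reduced_poly_quad_class:
  fixes \<beta> :: "nat \<Rightarrow> 'a::{field,finite}"
  assumes card: "CARD('a) = 2 * m + 1" and m: "m > 1" and s: "s \<in> {0, 1}"
  shows "(\<Sum>d\<in>quad_class s. d * (\<Sum>k\<le>2 * m. \<beta> k * d ^ k)) =
    of_nat m * ((-1) ^ s * \<beta> (m - 1) + \<beta> (2 * m - 1))"
proof -
  have "(\<Sum>d\<in>quad_class s. d * (\<Sum>k\<le>2 * m. \<beta> k * d ^ k)) =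
      (\<Sum>k\<le>2 * m. \<beta> k * (\<Sum>d\<in>quad_class s. d ^ Suc k))"
    unfolding sum_distrib_left by (subst sum.swap) (simp add: mult_ac)
  also have "\<dots> = (\<Sum>k\<in>{m - 1, 2 * m - 1}. \<beta> k * (\<Sum>d\<in>quad_class s. d ^ Suc k))"
  proof (rule sum.mono_neutral_right)
    show "\<forall>k\<in>{..2 * m} - {m - 1, 2 * m - 1}. \<beta> k * (\<Sum>d\<in>quad_class s. d ^ Suc k) = 0"
    proof
      fix k assume k: "k \<in> {..2 * m} - {m - 1, 2 * m - 1}"
      have "\<not> m dvd Suc k"
      proof
        assume "m dvd Suc k"
        then obtain l where l: "Suc k = m * l" ..
        \<comment> \<open>Since \<open>k \<le> 2 * m\<close>, \<open>Suc k\<close> is at most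
          \<open>2 * m + 1\<close>, which is below \<open>3 * m\<close> because
          \<open>m > 1\<close>.\<close>
        have "m * l < m * 3"
          using k m unfolding l[symmetric] by auto
        hence "l = 0 \<or> l = 1 \<or> l = 2"
          by auto
        thus False
          using k l m by auto
      qed
      thus "\<beta> k * (\<Sum>d\<in>quad_class s. d ^ Suc k) = 0"
        using m by (subst sum_power_quad_class[OF card _ s]) auto
    qed
  qed (use m in auto)
  also have "\<dots> = \<beta> (m - 1) * (\<Sum>d\<in>quad_class s. d ^ m) +
      \<beta> (2 * m - 1) * (\<Sum>d\<in>quad_class s. d ^ (2 * m))"
    using m by (simp del: power_Suc)
  also have "\<dots> = of_nat m * ((-1) ^ s * \<beta> (m - 1) + \<beta> (2 * m - 1))"
    using m by (simp add: sum_power_quad_class[OF card _ s] algebra_simps)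
  finally show ?thesis .
qed

section \<open>The inverse polynomial\<close>

text \<open>Substituting \<open>i = m + j\<close> turns the index of summation into the exponent,
  ready for comparison with the interpolation formula.\<close>

lemma inverse_poly_eq:
  assumes "q = 2 * m + 1"
  shows "inverse_poly q s t b =
    (\<Sum>j = 1..<m. monom ((-1) ^ (s + t) * (b (m + j) (m - 1) + (-1) ^ s * b (m + j) (2 * m - 1))) j)"
proof -
  have idx: "(q + 1) div 2 = m + 1" "(q - 1) div 2 = m" "(q - 3) div 2 = m - 1" "q - 2 = 2 * m - 1"
    using assms by linarith+
  show ?thesis
    unfolding inverse_poly_def idx
    by (rule sum.reindex_bij_witness[of _ "\<lambda>j. m + j" "\<lambda>i. i - m"]) auto
qed

lemma poly_inverse_poly:
  fixes f :: "'a::{field,finite} poly"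
  assumes q: "q = 2 * m + 1" and m: "m > 1" and card: "CARD('a) = q"
    and s: "s \<in> {0, 1}" and t: "t \<in> {0, 1}"
    and bij: "bij_betw (poly f) (quad_class s) (quad_class t)"
    and b: "\<And>i. m < i \<Longrightarrow> i < 2 * m \<Longrightarrow>
      [f ^ (2 * m - i) = (\<Sum>k = 0..2 * m. monom (b i k) k)] (mod (monom 1 q - monom 1 1))"
    and c: "c \<in> quad_class s"
  shows "poly (inverse_poly q s t b) (poly f c) = c"
proof -
  have card': "CARD('a) = 2 * m + 1"
    using q card by simp
  have m0: "m > 0"
    using m by simp
  let ?p = "\<lambda>j. (-1) ^ (s + t) * (b (m + j) (m - 1) + (-1) ^ s * b (m + j) (2 * m - 1))"
  let ?S = "\<lambda>j. \<Sum>d\<in>quad_class s. d / poly f d ^ j"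
  have fm: "poly f d ^ m = (-1) ^ t" if "d \<in> quad_class s" for d
    using bij_betwE[OF bij] that by (auto simp: quad_class_eq[OF card' m0 t])
  have f0: "poly f d \<noteq> 0" if "d \<in> quad_class s" for d
    using fm[OF that] m0 by (auto simp: zero_power)
  \<comment> \<open>For \<open>i = m + j\<close> the power of \<open>f\<close> in the hypothesis on
    \<open>b\<close> is \<open>m - j\<close>, and
    \<open>f(d) ^ (m - j) = (-1) ^ t / f(d) ^ j\<close>.\<close>
  have coeffs: "?S j = of_nat m * ?p j" if j: "j \<in> {1..<m}" for j
  proof -
    have "d / poly f d ^ j = (-1) ^ t * (d * (\<Sum>k\<le>2 * m. b (m + j) k * d ^ k))"
      if d: "d \<in> quad_class s" for d
    proof -
      have "poly (f ^ (2 * m - (m + j))) d = poly (\<Sum>k = 0..2 * m. monom (b (m + j) k) k) d"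
        using b[of "m + j"] j by (intro poly_eq_if_cong_field_poly) (simp add: card)
      hence "(\<Sum>k\<le>2 * m. b (m + j) k * d ^ k) = poly f d ^ (m - j)"
        by (simp add: poly_sum poly_monom atLeast0AtMost)
      also have "\<dots> = (-1) ^ t / poly f d ^ j"
        using j f0[OF d] fm[OF d] by (simp add: power_diff)
      finally show ?thesis
        by simp
    qed
    hence "?S j = (-1) ^ t * (\<Sum>d\<in>quad_class s. d * (\<Sum>k\<le>2 * m. b (m + j) k * d ^ k))"
      by (simp add: sum_distrib_left)
    also have "\<dots> = of_nat m * ?p j"
      \<comment> \<open>The power sums put the sign \<open>(-1) ^ s\<close> on the coefficient at
        \<open>m - 1\<close>; pulling it out moves it to the one at \<open>2 * m - 1\<close>, as
        \<open>(-1) ^ s\<close> is its own inverse.\<close>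
      unfolding sum_reduced_poly_quad_class[OF card' m s]
      using s t by (auto simp: algebra_simps)
    finally show ?thesis .
  qed
  \<comment> \<open>The constant term of the interpolation is the sum of all elements of the class,
    which vanishes because \<open>m > 1\<close> does not divide 1. Hence the exponents can start at
    1.\<close>
  have S0: "?S 0 = 0"
    using sum_power_quad_class[OF card' m0 s, of 1] m by simp
  have "of_nat m * poly (inverse_poly q s t b) (poly f c) =
      (\<Sum>j = 1..<m. of_nat m * ?p j * poly f c ^ j)"
    by (simp add: inverse_poly_eq[OF q] poly_sum poly_monom sum_distrib_left mult.assoc)
  also have "\<dots> = (\<Sum>j = 1..<m. ?S j * poly f c ^ j)"
    by (intro sum.cong) (simp_all add: coeffs)
  also have "\<dots> = (\<Sum>j<m. ?S j * poly f c ^ j)"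
  proof (rule sum.mono_neutral_left)
    show "\<forall>j\<in>{..<m} - {1..<m}. ?S j * poly f c ^ j = 0"
      using S0 by (auto simp: not_le)
  qed auto
  also have "\<dots> = of_nat m * c"
    using bij c by (intro sum_interpolation_quad_class[OF card' m0 t]) (auto simp: bij_betw_def)
  finally show ?thesis
    using of_nat_half_card_neq_zero[OF card'] by simp
qed

theorem theorem2:
  fixes f :: "'a::{field,finite} poly"
    and b :: "nat \<Rightarrow> nat \<Rightarrow> 'a"
    and q s t :: nat
  assumes "primepow q" and "odd q" and "q > 3" and "CARD('a) = q"
    and "s \<in> {0, 1}" and "t \<in> {0, 1}"
    and "bij_betw (poly f) (quad_class s) (quad_class t)"
    and "\<And>i. (q + 1) div 2 \<le> i \<Longrightarrow> i \<le> q - 2 \<Longrightarrow>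
           [f ^ (q - 1 - i) = (\<Sum>k = 0..q - 1. monom (b i k) k)] (mod (monom 1 q - monom 1 1))"
  shows "(\<exists>h. is_inverse_on q (quad_class s) f h) \<and>
         (\<forall>h. is_inverse_on q (quad_class s) f h \<longrightarrow>
            [inverse_poly q s t b = h] (mod (monom 1 ((q - 1) div 2) + [:(-1) ^ (t + 1):]))) \<and>
         (\<forall>c\<in>quad_class s. poly (inverse_poly q s t b) (poly f c) = c)"
proof -
  obtain m where q: "q = 2 * m + 1"
    using \<open>odd q\<close> by (elim oddE)
  with \<open>q > 3\<close> have m: "m > 1" "m > 0"
    by auto
  have card: "CARD('a) = 2 * m + 1"
    using assms(4) q by simp
  let ?P = "inverse_poly q s t b" and ?M = "monom 1 m + [:(-1) ^ (t + 1):] :: 'a poly"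
  have inv: "\<forall>c\<in>quad_class s. poly ?P (poly f c) = c"
  proof
    fix c :: 'a
    assume "c \<in> quad_class s"
    moreover have "[f ^ (2 * m - i) = (\<Sum>k = 0..2 * m. monom (b i k) k)] (mod (monom 1 q - monom 1 1))"
      if "m < i" "i < 2 * m" for i
      using assms(8)[of i] that by (simp add: q)
    ultimately show "poly ?P (poly f c) = c"
      using q m(1) assms(4-7) by (intro poly_inverse_poly)
  qed
  have "degree ?P \<le> q - 1"
    unfolding inverse_poly_eq[OF q] using q
    by (intro degree_sum_le) (auto intro!: order.trans[OF degree_monom_le])
  moreover have "poly ?P 0 = 0"
    unfolding inverse_poly_eq[OF q] by (auto simp: poly_sum poly_monom intro!: sum.neutral)
  \<comment> \<open>The polynomial itself witnesses the existence of \<open>h\<close>.\<close>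
  ultimately have ex: "is_inverse_on q (quad_class s) f ?P"
    using inv by (simp add: is_inverse_on_def)
  have "[?P = h] (mod ?M)" if h: "is_inverse_on q (quad_class s) f h" for h
  proof (rule cong_if_eq_on_roots[where A = "quad_class t"])
    \<comment> \<open>The degree of the modulus equals the size of \<open>quad_class t\<close>, so
      agreement on that class suffices for the congruence.\<close>
    have "degree ?M = m"
      using m by (subst degree_add_eq_left) (auto simp: degree_monom_eq)
    thus "0 < degree ?M" "degree ?M \<le> card (quad_class t :: 'a set)"
      using m by (simp_all add: card_quad_class[OF card m(2) assms(6)])
  next
    fix y :: 'a assume y: "y \<in> quad_class t"
    thus "poly ?M y = 0"
      by (simp add: poly_monom quad_class_eq[OF card m(2) assms(6)])
    \<comment> \<open>Surjectivity onto \<open>quad_class t\<close> makes the prescribed values of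
      \<open>h\<close> cover the whole class.\<close>
    obtain c where "c \<in> quad_class s" "y = poly f c"
      using y assms(7) by (auto simp: bij_betw_def)
    thus "poly ?P y = poly h y"
      using inv h by (simp add: is_inverse_on_def)
  qed
  moreover have "(q - 1) div 2 = m"
    by (simp add: q)
  ultimately show ?thesis
    using ex inv by auto
qed

end
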